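(* Let $H$ be the graph on vertices $\{1,\dots,12\}$ with the 18 edges $12,23,34,45,56,16$; $\{1,7\},\{4,7\},\{2,8\},\{5,8\},\{3,9\},\{6,9\}$; $\{7,10\},\{8,11\},\{9,12\}$; $\{10,11\},\{10,12\},\{11,12\}$. If $A\in\mathcal{S}(H)$ and $\mathbf{m}(A)=(3,5,4)$, then $A$ does not have the SSP. The matrix $$B=\begin{pmatrix} 1 & -1 & 0 & 0 & 0 & -1 & \sqrt{2} & 0 & 0 & 0 & 0 & 0 \\ -1 & 1 & -1 & 0 & 0 & 0 & 0 & \sqrt{2} & 0 & 0 & 0 & 0 \\ 0 & -1 & 1 & -1 & 0 & 0 & 0 & 0 & \sqrt{2} & 0 & 0 & 0 \\ 0 & 0 & -1 & 1 & -1 & 0 & \sqrt{2} & 0 & 0 & 0 & 0 & 0 \\ 0 & 0 & 0 & -1 & 1 & -1 & 0 & \sqrt{2} & 0 & 0 & 0 & 0 \\ -1 & 0 & 0 & 0 & -1 & 1 & 0 & 0 & \sqrt{2} & 0 & 0 & 0 \\ \sqrt{2} & 0 & 0 & \sqrt{2} & 0 & 0 & -2 & 0 & 0 & 2 & 0 & 0 \\ 0 & \sqrt{2} & 0 & 0 & \sqrt{2} & 0 & 0 & -2 & 0 & 0 & 2 & 0 \\ 0 & 0 & \sqrt{2} & 0 & 0 & \sqrt{2} & 0 & 0 & -2 & 0 & 0 & 2 \\ 0 & 0 & 0 & 0 & 0 & 0 & 2 & 0 & 0 & 0 & 1 & 1 \\ 0 & 0 & 0 & 0 & 0 & 0 &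 0 & 2 & 0 & 1 & 0 & 1 \\ 0 & 0 & 0 & 0 & 0 & 0 & 0 & 0 & 2 & 1 & 1 & 0 \end{pmatrix}\in\mathcal{S}(H)$$ has spectrum $\{-4,-4,-4,0,0,0,0,0,3,3,3,3\}$, $\mathbf{m}(B)=(3,5,4)$, and $B$ has the SMP.
   Context: All matrices are real and symmetric. For a graph $G$ on vertices $\{1,\dots,n\}$, $\mathcal{S}(G)$ is the set of real symmetric $n\times n$ matrices $A=[a_{ij}]$ such that, for $i\neq j$, $a_{ij}\ne 0$ if and only if $ij$ is an edge of $G$ (diagonal entries are free). If $A$ has distinct eigenvalues $\lambda_1<\dots<\lambda_q$ with multiplicities $m_1,\dots,m_q$, its ordered multiplicity list is $\mathbf{m}(A)=(m_1,\dots,m_q)$. Let $\circ$ be the entrywise product and $[A,X]=AX-XA$. $A$ has the Strong Spectral Property (SSP) if the only symmetric $X$ with $A\circ X=O$, $I\circ X=O$, $[A,X]=O$ is $X=O$. An $n\times n$ matrix $A$ has the Strong Multiplicity Property (SMP) if the only symmetric $X$ with $A\circ X=O$, $I\circ X=O$, $[A,X]=O$ and $\operatorname{tr}(A^iX)=0$ for $i=2,\dots,n-1$ is $X=O$. *)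

theory Defs
  imports "Jordan_Normal_Form.Spectral_Radius"
begin

definition symmetric_mat :: "real mat \<Rightarrow> bool" where
  "symmetric_mat A \<longleftrightarrow> transpose_mat A = A"

definition mat_trace :: "real mat \<Rightarrow> real" where
  "mat_trace A = (\<Sum>i<dim_row A. A $$ (i, i))"

definition hadamard :: "real mat \<Rightarrow> real mat \<Rightarrow> real mat" where
  "hadamard A X = mat (dim_row A) (dim_col A) (\<lambda>(i, j). A $$ (i, j) * X $$ (i, j))"

definition commutator :: "real mat \<Rightarrow> real mat \<Rightarrow> real mat" where
  "commutator A X = A * X - X * A"

text \<open>A simple graph on the vertices 1, ..., n is given by n and its set of two-element edges.
  Matrix indices start at 0, so row and column i belong to the vertex i + 1.\<close>

definition graph_matrices :: "nat \<Rightarrow> nat set set \<Rightarrow> real mat set" where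
  "graph_matrices n E = {A \<in> carrier_mat n n. symmetric_mat A \<and>
     (\<forall>i<n. \<forall>j<n. i \<noteq> j \<longrightarrow> (A $$ (i, j) \<noteq> 0 \<longleftrightarrow> {i + 1, j + 1} \<in> E))}"

text \<open>The multiplicity of an eigenvalue is its multiplicity as a root of the characteristic
  polynomial; for real symmetric matrices it equals the dimension of the eigenspace, and all
  complex eigenvalues are real.\<close>

definition eigenvalue_mset :: "real mat \<Rightarrow> real multiset" where
  "eigenvalue_mset A = proots (char_poly A)"

definition ordered_mult_list :: "real mat \<Rightarrow> nat list" where
  "ordered_mult_list A = map (count (eigenvalue_mset A)) (sorted_list_of_set (spectrum A))"

definition SSP :: "real mat \<Rightarrow> bool" where
  "SSP A \<longleftrightarrow> (let n = dim_row A in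
     \<forall>X \<in> carrier_mat n n. symmetric_mat X \<longrightarrow>
       hadamard A X = 0\<^sub>m n n \<longrightarrow> hadamard (1\<^sub>m n) X = 0\<^sub>m n n \<longrightarrow>
       commutator A X = 0\<^sub>m n n \<longrightarrow> X = 0\<^sub>m n n)"

definition SMP :: "real mat \<Rightarrow> bool" where
  "SMP A \<longleftrightarrow> (let n = dim_row A in
     \<forall>X \<in> carrier_mat n n. symmetric_mat X \<longrightarrow>
       hadamard A X = 0\<^sub>m n n \<longrightarrow> hadamard (1\<^sub>m n) X = 0\<^sub>m n n \<longrightarrow>
       commutator A X = 0\<^sub>m n n \<longrightarrow>
       (\<forall>i. 2 \<le> i \<and> i \<le> n - 1 \<longrightarrow> mat_trace ((A ^\<^sub>m i) * X) = 0) \<longrightarrow> X = 0\<^sub>m n n)"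

definition H_edges :: "nat set set" where
  "H_edges =
    {{1, 2}, {2, 3}, {3, 4}, {4, 5}, {5, 6}, {1, 6},
     {1, 7}, {4, 7}, {2, 8}, {5, 8}, {3, 9}, {6, 9},
     {7, 10}, {8, 11}, {9, 12},
     {10, 11}, {10, 12}, {11, 12}}"

definition B_mat :: "real mat" where
  "B_mat = mat_of_rows_list 12
    [[ 1, -1,  0,  0,  0, -1, sqrt 2, 0, 0, 0, 0, 0],
     [-1,  1, -1,  0,  0,  0, 0, sqrt 2, 0, 0, 0, 0],
     [ 0, -1,  1, -1,  0,  0, 0, 0, sqrt 2, 0, 0, 0],
     [ 0,  0, -1,  1, -1,  0, sqrt 2, 0, 0, 0, 0, 0],
     [ 0,  0,  0, -1,  1, -1, 0, sqrt 2, 0, 0, 0, 0],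
     [-1,  0,  0,  0, -1,  1, 0, 0, sqrt 2, 0, 0, 0],
     [sqrt 2, 0, 0, sqrt 2, 0, 0, -2, 0, 0, 2, 0, 0],
     [0, sqrt 2, 0, 0, sqrt 2, 0, 0, -2, 0, 0, 2, 0],
     [0, 0, sqrt 2, 0, 0, sqrt 2, 0, 0, -2, 0, 0, 2],
     [0, 0, 0, 0, 0, 0, 2, 0, 0, 0, 1, 1],
     [0, 0, 0, 0, 0, 0, 0, 2, 0, 1, 0, 1],
     [0, 0, 0, 0, 0, 0, 0, 0, 2, 1, 1, 0]]"

end

theory Submission
  imports Defs "Jordan_Normal_Form.Jordan_Normal_Form_Uniqueness"
begin

text \<open>The symmetric matrices commuting with a symmetric matrix with multiplicities
  \<open>m\<^sub>1, \<dots>, m\<^sub>q\<close> form a space of dimension \<open>\<Sum>i. (m\<^sub>i + 1 choose 2)\<close>. For \<open>(3, 5, 4)\<close> this is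
  31, while the SSP conditions outside the commutator impose only one linear equation for each of
  the 12 vertices and 18 edges of \<open>H\<close>, so a nonzero solution remains. For \<open>B\<close>, a diagonal scaling
  removes the square roots; the scaled matrix is diagonalized explicitly, and its commutator
  equations have a one-dimensional solution space, on which \<open>tr (B\<^sup>2 X)\<close> does not vanish.\<close>

section \<open>Diagonalizing symmetric matrices through their Jordan blocks\<close>

lemma symmetric_matD:
  assumes "symmetric_mat A" "A \<in> carrier_mat n n" "i < n" "j < n"
  shows "A $$ (i, j) = A $$ (j, i)"
  using assms by (metis carrier_matD index_transpose_mat(1) symmetric_mat_def)

text \<open>If \<open>M (M v) = 0\<close>, moving one factor across the scalar product gives
  \<open>(M v) \<bullet> (M v) = v \<bullet> (M (M v)) = 0\<close>, and over the reals this forces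
  \<open>M v = 0\<close>.\<close>

lemma mat_kernel_square_symmetric:
  assumes M: "M \<in> carrier_mat n n" and sym: "symmetric_mat M"
  shows "mat_kernel (M * M) = mat_kernel M"
proof
  show "mat_kernel M \<subseteq> mat_kernel (M * M)"
    by (rule mat_kernel_mult_subset[OF M M])
  show "mat_kernel (M * M) \<subseteq> mat_kernel M"
  proof
    fix v assume v: "v \<in> mat_kernel (M * M)"
    have MM: "M * M \<in> carrier_mat n n" using M by simp
    note vn = mat_kernelD(1)[OF MM v]
    have "(M *\<^sub>v v) \<bullet> (M *\<^sub>v v) = v \<bullet> (M *\<^sub>v (M *\<^sub>v v))"
      using transpose_vec_mult_scalar[OF M vn, of "M *\<^sub>v v"] M vn sym
      by (simp add: symmetric_mat_def comm_scalar_prod[of _ n])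
    also have "\<dots> = 0"
      using mat_kernelD(2)[OF MM v] M vn by simp
    finally have "(M *\<^sub>v v) \<bullet>c (M *\<^sub>v v) = 0" by simp
    then have "M *\<^sub>v v = 0\<^sub>v n"
      using conjugate_square_eq_0_vec[of "M *\<^sub>v v" n] M vn by simp
    then show "v \<in> mat_kernel M" by (rule mat_kernelI[OF M vn])
  qed
qed

text \<open>A shift of a symmetric matrix by a multiple of the identity is still symmetric, so its
  square has the same kernel. This is what rules out Jordan blocks of size above 1.\<close>

lemma dim_gen_eigenspace_symmetric:
  assumes A: "A \<in> carrier_mat n n" and sym: "symmetric_mat A"
  shows "dim_gen_eigenspace A ev 2 = dim_gen_eigenspace A ev 1"
proof -
  let ?M = "char_matrix A ev"
  have M: "?M \<in> carrier_mat n n" using A by simp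
  have symM: "symmetric_mat ?M"
    using symmetric_matD[OF sym A] A
    by (auto simp: symmetric_mat_def char_matrix_def intro!: eq_matI)
  have "kernel_dim (?M * ?M) = kernel_dim ?M"
    using mat_kernel_square_symmetric[OF M symM] M by (simp add: kernel_dim_def)
  then show ?thesis
    using M by (simp add: dim_gen_eigenspace_def numeral_2_eq_2)
qed

text \<open>For the block sizes \<open>ns\<close> of one eigenvalue, the sum of
  \<open>min k n\<close> is the dimension of the generalized eigenspace of order \<open>k\<close>.
  The sums for 2 and 1 compare term by term, so equality excludes every block of size at least
  2.\<close>

lemma sum_list_min_2_eq_min_1:
  fixes ns :: "nat list"
  assumes "(\<Sum>n\<leftarrow>ns. min 2 n) = (\<Sum>n\<leftarrow>ns. min 1 n)" "n \<in> set ns"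
  shows "n \<le> 1"
  using assms
proof (induction ns)
  case (Cons m ns)
  have "(\<Sum>n\<leftarrow>ns. min 1 n) \<le> (\<Sum>n\<leftarrow>ns. min 2 n)" by (intro sum_list_mono min.mono) simp_all
  moreover have "min 2 m + (\<Sum>n\<leftarrow>ns. min 2 n) = min 1 m + (\<Sum>n\<leftarrow>ns. min 1 n)"
    using Cons.prems(1) by simp
  ultimately have "m \<le> 1" "(\<Sum>n\<leftarrow>ns. min 2 n) = (\<Sum>n\<leftarrow>ns. min 1 n)"
    by linarith+
  with Cons show ?case by auto
qed simp

lemma jordan_matrix_blocks_1:
  "jordan_matrix (map (Pair 1) es) = mat_diag (length es) (nth es)"
proof (induction es)
  case Nil
  then show ?case by (auto simp: jordan_matrix_def mat_diag_def)
next
  case (Cons e es)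
  have [simp]: "sum_list (map (fst \<circ> Pair (Suc 0)) es) = length es"
    by (induction es) auto
  show ?case
    using Cons by (auto simp: jordan_matrix_Cons mat_diag_def jordan_block_def nth_Cons'
      intro!: eq_matI)
qed

text \<open>A split characteristic polynomial provides a Jordan form, and the kernel dimensions
  force all its blocks to have size 1. The resulting similarity need not be orthogonal.\<close>

lemma symmetric_diagonalization:
  assumes A: "A \<in> carrier_mat n n" and sym: "symmetric_mat A"
    and split: "char_poly A = (\<Prod>a\<leftarrow>as. [:- a, 1:])"
  obtains es where "similar_mat A (mat_diag (length es) (nth es))"
proof -
  obtain n_as where jnf: "jordan_nf A n_as" using jordan_nf_exists[OF A split] by blast
  have one: "k = 1" if "(k, a) \<in> set n_as" for k a
  proof -
    let ?ns = "map fst [(n, e)\<leftarrow>n_as . e = a]"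
    have "(\<Sum>n\<leftarrow>?ns. min 2 n) = (\<Sum>n\<leftarrow>?ns. min 1 n)"
      using dim_gen_eigenspace_symmetric[OF A sym, of a] by (simp only: dim_gen_eigenspace[OF jnf])
    moreover have "k \<in> set ?ns" using that by force
    ultimately have "k \<le> 1" by (rule sum_list_min_2_eq_min_1)
    \<comment> \<open>The kernel dimensions do not see blocks of size 0; these are excluded by the
      definition of a Jordan normal form.\<close>
    moreover have "k \<noteq> 0" using jnf that by (force simp: jordan_nf_def)
    ultimately show ?thesis by simp
  qed
  have "n_as = map (Pair 1) (map snd n_as)"
    using one by (auto intro!: nth_equalityI simp: prod_eq_iff) (metis nth_mem prod.collapse)
  then have "jordan_matrix n_as = mat_diag (length (map snd n_as)) (nth (map snd n_as))"
    using jordan_matrix_blocks_1 by metis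
  with jnf show thesis by (intro that[of "map snd n_as"]) (simp add: jordan_nf_def)
qed

section \<open>Characteristic polynomials and eigenvalue multisets\<close>

lemma char_poly_mat_diag:
  "char_poly (mat_diag (length es) (nth es)) = (\<Prod>a\<leftarrow>es. [:- a, 1 :: 'a :: comm_ring_1:])"
proof -
  have "diag_mat (mat_diag (length es) (nth es)) = es"
    by (auto simp: diag_mat_def mat_diag_def intro: nth_equalityI)
  then show ?thesis
    by (subst char_poly_upper_triangular[of _ "length es"]) (auto simp: mat_diag_def)
qed

lemma proots_linear_factors:
  fixes es :: "'a :: idom list"
  shows "proots (\<Prod>a\<leftarrow>es. [:- a, 1:]) = mset es"
proof (induction es)
  case (Cons e es)
  have "(\<Prod>a\<leftarrow>es. [:- a, 1:]) \<noteq> 0" by (auto simp: prod_list_zero_iff)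
  then show ?case
    using Cons proots_mult[of "[:- e, 1:]" "\<Prod>a\<leftarrow>es. [:- a, 1:]"] by (simp del: mult_pCons_left)
qed simp

lemma eigenvalue_mset_similar_diag:
  assumes "similar_mat A (mat_diag (length es) (nth es))"
  shows "eigenvalue_mset A = mset es"
  using char_poly_similar[OF assms]
  by (simp add: eigenvalue_mset_def char_poly_mat_diag proots_linear_factors)

text \<open>\<open>eigenvalue_mset\<close> collects real roots only, so the size condition says that
  every eigenvalue is real. Linear factors are then split off one root at a time, which keeps the
  quotient monic.\<close>

lemma char_poly_splits:
  fixes A :: "real mat"
  assumes A: "A \<in> carrier_mat n n" and size: "size (eigenvalue_mset A) = n"
  obtains as where "char_poly A = (\<Prod>a\<leftarrow>as. [:- a, 1:])"
proof -
  let ?p = "char_poly A"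
  have deg: "degree ?p = n" and monic: "coeff ?p n = 1"
    using degree_monic_char_poly[OF A] by auto
  have aux: "\<exists>as. p = (\<Prod>a\<leftarrow>as. [:- a, 1:])"
    if "degree p = k" "coeff p k = 1" "size (proots p) = k" for p :: "real poly" and k
    using that
  proof (induction k arbitrary: p)
    case 0
    then have "p = 1" by (metis degree_0_id one_pCons)
    then show ?case by (intro exI[of _ "[]"]) simp
  next
    case (Suc k)
    then have p0: "p \<noteq> 0" by auto
    obtain a where a: "a \<in># proots p" using Suc.prems(3) by (metis size_eq_Suc_imp_elem)
    then have "poly p a = 0" using p0 by simp
    then obtain q where q: "p = [:- a, 1:] * q" by (auto simp: poly_eq_0_iff_dvd)
    then have q0: "q \<noteq> 0" using p0 by auto
    have "degree q = k" using Suc.prems(1) q0 degree_mult_eq[of "[:- a, 1:]" q] unfolding q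
      by (simp del: mult_pCons_left)
    moreover have "coeff q k = 1"
      using Suc.prems(1,2) \<open>degree q = k\<close> lead_coeff_mult[of "[:- a, 1:]" q] unfolding q
      by (simp del: mult_pCons_left)
    moreover have "size (proots q) = k"
      using Suc.prems(3) q0 proots_mult[of "[:- a, 1:]" q] unfolding q
      by (simp del: mult_pCons_left)
    ultimately obtain as where "q = (\<Prod>a\<leftarrow>as. [:- a, 1:])" using Suc.IH by blast
    then show ?case using q by (intro exI[of _ "a # as"]) simp
  qed
  from aux[OF deg monic] size that show thesis by (auto simp: eigenvalue_mset_def)
qed

section \<open>Counting dimensions: the bound forced by the SSP\<close>

text \<open>Zero rows pad the coefficients to a square matrix. Row \<open>card J\<close> is one of
  them, so expanding along it shows that the determinant vanishes, which yields a nonzero kernel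
  vector.\<close>

lemma underdetermined_system:
  fixes f :: "'j \<Rightarrow> 'i \<Rightarrow> real"
  assumes I: "finite I" and J: "finite J" and less: "card J < card I"
  obtains x where "\<exists>i\<in>I. x i \<noteq> 0" "\<And>j. j \<in> J \<Longrightarrow> (\<Sum>i\<in>I. f j i * x i) = 0"
proof -
  let ?n = "card I" and ?m = "card J"
  obtain h where h: "bij_betw h {0..<?n} I" using ex_bij_betw_nat_finite[OF I] by blast
  obtain g where g: "bij_betw g {0..<?m} J" using ex_bij_betw_nat_finite[OF J] by blast
  define M where "M = mat ?n ?n (\<lambda>(r, k). if r < ?m then f (g r) (h k) else 0)"
  have M: "M \<in> carrier_mat ?n ?n" by (simp add: M_def)
  have "det M = (\<Sum>k<?n. M $$ (?m, k) * cofactor M ?m k)"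
    by (rule laplace_expansion_row[OF M less])
  also have "\<dots> = 0" using less by (simp add: M_def)
  finally obtain v where v: "v \<in> carrier_vec ?n" "v \<noteq> 0\<^sub>v ?n" "M *\<^sub>v v = 0\<^sub>v ?n"
    using det_0_iff_vec_prod_zero[OF M] by blast
  define x where "x i = v $ (inv_into {0..<?n} h i)" for i
  have xh: "x (h k) = v $ k" if "k < ?n" for k
    using that h by (simp add: x_def bij_betw_def)
  obtain k where k: "k < ?n" "v $ k \<noteq> 0" using v(1,2) by (metis carrier_vecD eq_vecI index_zero_vec)
  show thesis
  proof
    show "\<exists>i\<in>I. x i \<noteq> 0" using k xh[of k] h by (metis atLeastLessThan_iff bij_betwE le0)
    fix j assume "j \<in> J"
    then obtain r where r: "r < ?m" "j = g r" using g by (force simp: bij_betw_def)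
    have "(\<Sum>i\<in>I. f j i * x i) = (\<Sum>k\<in>{0..<?n}. f j (h k) * x (h k))"
      using sum.reindex_bij_betw[OF h, of "\<lambda>i. f j i * x i"] by simp
    also have "\<dots> = (\<Sum>k\<in>{0..<?n}. M $$ (r, k) * v $ k)"
      using r less by (intro sum.cong) (auto simp: M_def xh)
    also have "\<dots> = (M *\<^sub>v v) $ r" using v(1) M r less by (simp add: scalar_prod_def)
    also have "\<dots> = 0" using v(3) r less by simp
    finally show "(\<Sum>i\<in>I. f j i * x i) = 0" .
  qed
qed

text \<open>These pairs index the free entries of a symmetric matrix commuting with the diagonal
  matrix of \<open>es\<close>. In the induction a new head \<open>e\<close> adds the pair
  \<open>(0, 0)\<close> and one pair \<open>(0, Suc j)\<close> for each occurrence of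
  \<open>e\<close> in the tail.\<close>

lemma card_equal_pairs:
  assumes "finite S" "set es \<subseteq> S"
  shows "card {(i, j). i \<le> j \<and> j < length es \<and> es ! i = es ! j}
    = (\<Sum>x\<in>S. Suc (count (mset es) x) choose 2)"
  using assms(2)
proof (induction es)
  case Nil
  then show ?case by (simp add: choose_two)
next
  case (Cons e es)
  let ?P = "\<lambda>es. {(i, j). i \<le> j \<and> j < length es \<and> es ! i = es ! j}"
  have fin: "finite (?P es)" for es :: "'a list"
    by (rule finite_subset[of _ "{..length es} \<times> {..length es}"]) auto
  let ?R = "{j. j < length es \<and> es ! j = e}"
  have split: "?P (e # es) = insert (0, 0) ((\<lambda>j. (0, Suc j)) ` ?R \<union> map_prod Suc Suc ` ?P es)"
    (is "?L = ?R'")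
  proof (rule Set.set_eqI)
    fix p :: "nat \<times> nat"
    obtain i j where p: "p = (i, j)" by force
    show "p \<in> ?L \<longleftrightarrow> p \<in> ?R'"
      unfolding p by (cases i; cases j) (auto simp: image_iff)
  qed
  have "card (?P (e # es)) = Suc (card ?R + card (?P es))"
    unfolding split
    by (subst card_insert_disjoint, use fin in auto)
      (subst card_Un_disjoint, use fin in \<open>auto simp: card_image inj_on_def\<close>)
  also have "card ?R = count (mset es) e"
    by (simp add: count_mset count_list_eq_length_filter length_filter_conv_card eq_commute)
  also have "card (?P es) = (\<Sum>x\<in>S. Suc (count (mset es) x) choose 2)"
    using Cons by simp
  \<comment> \<open>Only the summand at \<open>e\<close> changes: if \<open>m\<close> is the old
    multiplicity, it grows by \<open>m + 1\<close>.\<close>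
  also have "Suc (count (mset es) e + \<dots>) = (\<Sum>x\<in>S. Suc (count (mset (e # es)) x) choose 2)"
  proof -
    have "(\<Sum>x\<in>S - {e}. Suc (count (mset (e # es)) x) choose 2)
        = (\<Sum>x\<in>S - {e}. Suc (count (mset es) x) choose 2)"
      by (intro sum.cong) auto
    then show ?thesis
      using assms(1) Cons.prems
      by (simp add: sum.remove[of S e] numeral_2_eq_2 del: binomial_Suc_Suc) simp
  qed
  finally show ?case .
qed

text \<open>If \<open>A P = P D\<close> and \<open>S\<close> is symmetric and commutes with the
  diagonal \<open>D\<close>, then \<open>X = P S P^T\<close> is symmetric and commutes with
  \<open>A\<close>, even for non-orthogonal \<open>P\<close>. The left side counts the parameters of
  \<open>S\<close>, the right side the entries of \<open>X\<close> required to vanish. An excess of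
  parameters leaves a nonzero \<open>X\<close> that contradicts the SSP.\<close>

lemma SSP_imp_card_bound:
  assumes A: "A \<in> carrier_mat n n" and sym: "symmetric_mat A"
    and size: "size (eigenvalue_mset A) = n" and ssp: "SSP A"
  shows "(\<Sum>x\<in>set_mset (eigenvalue_mset A). Suc (count (eigenvalue_mset A) x) choose 2)
    \<le> card {(i, j). i \<le> j \<and> j < n \<and> (i = j \<or> A $$ (i, j) \<noteq> 0)}"
    (is "?d \<le> card ?J")
proof (rule ccontr)
  assume less: "\<not> ?d \<le> card ?J"
  obtain as where "char_poly A = (\<Prod>a\<leftarrow>as. [:- a, 1:])"
    using char_poly_splits[OF A size] by blast
  then obtain es where sim: "similar_mat A (mat_diag (length es) (nth es))"
    using symmetric_diagonalization[OF A sym] by blast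
  have es: "eigenvalue_mset A = mset es" by (rule eigenvalue_mset_similar_diag[OF sim])
  with size have n: "length es = n" by simp
  define D where "D = mat_diag n (nth es)"
  from sim n obtain P Q where wit: "similar_mat_wit A D P Q"
    by (auto simp: similar_mat_def D_def)
  note PQ = similar_mat_witD2[OF A wit]
  have D: "D \<in> carrier_mat n n" and P: "P \<in> carrier_mat n n" and Q: "Q \<in> carrier_mat n n"
    using PQ by auto
  have "A * P = P * D * (Q * P)"
    unfolding PQ(3) using P Q D by (simp add: assoc_mult_mat[of _ n n _ n _ n])
  then have AP: "A * P = P * D" using PQ(2) P D by simp
  let ?I = "{(i, j). i \<le> j \<and> j < length es \<and> es ! i = es ! j}"
  let ?K = "{(i, j). i < n \<and> j < n \<and> es ! i = es ! j}"
  let ?h = "\<lambda>(i, j). (min i j, max i j :: nat)"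
  have finK: "finite ?K" by (rule finite_subset[of _ "{..n} \<times> {..n}"]) auto
  have finI: "finite ?I" by (rule finite_subset[of _ ?K]) (use n finK in auto)
  have finJ: "finite ?J" by (rule finite_subset[of _ "{..n} \<times> {..n}"]) auto
  have "card ?J < card ?I"
    using less card_equal_pairs[of "set es" es] by (simp add: es)
  \<comment> \<open>\<open>F q p\<close> is the coefficient of the parameter \<open>x p\<close> in
    the entry of \<open>X\<close> at \<open>q\<close>. The fibre over an off-diagonal
    \<open>p\<close> contains both mirror positions, since \<open>S\<close> is to be
    symmetric.\<close>
  define F where "F q p = (\<Sum>k\<in>{k \<in> ?K. ?h k = p}. P $$ (fst q, fst k) * P $$ (snd q, snd k))"
    for q p
  obtain x where x0: "\<exists>p\<in>?I. x p \<noteq> 0"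
    and x: "\<And>q. q \<in> ?J \<Longrightarrow> (\<Sum>p\<in>?I. F q p * x p) = 0"
    using underdetermined_system[OF finI finJ \<open>card ?J < card ?I\<close>, of F] by blast
  define S where "S = mat n n (\<lambda>(i, j). if es ! i = es ! j then x (?h (i, j)) else 0)"
  have S: "S \<in> carrier_mat n n" by (simp add: S_def)
  have symS: "transpose_mat S = S"
    by (auto simp: S_def min.commute max.commute intro!: eq_matI)
  have DS: "D * S = S * D"
    unfolding D_def mat_diag_mult_left[OF S] mat_diag_mult_right[OF S]
    by (auto simp: S_def intro!: eq_matI)
  define X where "X = P * S * transpose_mat P"
  have X: "X \<in> carrier_mat n n" using P S by (simp add: X_def)
  have symX: "transpose_mat X = X"
    using P S by (simp add: X_def transpose_mult[of _ n n _ n] symS assoc_mult_mat[of _ n n _ n _ n])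
  have X_index: "X $$ (r, c) = (\<Sum>p\<in>?I. F (r, c) p * x p)" if "r < n" "c < n" for r c
  proof -
    let ?g = "\<lambda>k. P $$ (r, fst k) * P $$ (c, snd k)"
    have "X $$ (r, c) = (\<Sum>i\<in>{0..<n}. \<Sum>j\<in>{0..<n}. ?g (i, j) * S $$ (i, j))"
      using that P S by (simp add: X_def scalar_prod_def sum_distrib_left mult_ac)
    also have "\<dots> = (\<Sum>k\<in>{0..<n} \<times> {0..<n}. ?g k * S $$ k)"
      by (simp only: sum.cartesian_product split_def prod.collapse)
    also have "\<dots> = (\<Sum>k\<in>?K. ?g k * x (?h k))"
      by (rule sum.mono_neutral_cong_right) (auto simp: S_def split: if_splits)
    also have "\<dots> = (\<Sum>p\<in>?I. \<Sum>k\<in>{k \<in> ?K. ?h k = p}. ?g k * x (?h k))"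
      by (rule sum.group[symmetric, OF finK finI]) (auto simp: n min_def max_def)
    also have "\<dots> = (\<Sum>p\<in>?I. F (r, c) p * x p)"
      by (auto simp: F_def sum_distrib_right intro!: sum.cong)
    finally show ?thesis .
  qed
  have X_upper: "X $$ (i, j) = 0" if "i \<le> j" "j < n" "i = j \<or> A $$ (i, j) \<noteq> 0" for i j
    using x[of "(i, j)"] X_index[of i j] that by simp
  \<comment> \<open>The linear system covers positions on or above the diagonal; the symmetry of
    \<open>A\<close> and \<open>X\<close> carries the zeros below it.\<close>
  have X_zero: "X $$ (i, j) = 0" if "i < n" "j < n" "i = j \<or> A $$ (i, j) \<noteq> 0" for i j
    using X_upper[of i j] X_upper[of j i] that symmetric_matD[OF sym A, of i j]
      symmetric_matD[of X n i j] symX X by (cases "i \<le> j") (auto simp: symmetric_mat_def)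
  have "A * X = (A * P) * S * transpose_mat P"
    using A P S by (simp add: X_def assoc_mult_mat[of _ n n _ n _ n])
  also have "\<dots> = P * (D * S) * transpose_mat P"
    unfolding AP using P S D by (simp add: assoc_mult_mat[of _ n n _ n _ n])
  finally have AX: "A * X = P * (D * S) * transpose_mat P" .
  \<comment> \<open>Commutation amounts to symmetry of \<open>A X = P (D S) P^T\<close>, which holds
    because \<open>D S = S D\<close>.\<close>
  have "X * A = transpose_mat (A * X)"
    using A X sym symX by (simp add: transpose_mult[of _ n n _ n] symmetric_mat_def)
  also have "\<dots> = P * (S * transpose_mat D) * transpose_mat P"
    unfolding AX using P S D
    by (simp add: transpose_mult[of _ n n _ n] symS assoc_mult_mat[of _ n n _ n _ n])
  also have "transpose_mat D = D" by (auto simp: D_def mat_diag_def intro!: eq_matI)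
  finally have XA: "X * A = A * X" by (simp only: AX DS)
  have "commutator A X = 0\<^sub>m n n"
    unfolding commutator_def XA by (rule minus_r_inv_mat[of _ n n]) (use A X in simp)
  moreover have "A $$ (i, j) * X $$ (i, j) = 0" if "i < n" "j < n" for i j
    using X_zero[of i j] that by auto
  then have "hadamard A X = 0\<^sub>m n n" "hadamard (1\<^sub>m n) X = 0\<^sub>m n n"
    using A X_zero by (auto simp: hadamard_def intro!: eq_matI)
  ultimately have "X = 0\<^sub>m n n"
    using ssp A X symX by (simp add: SSP_def symmetric_mat_def)
  \<comment> \<open>The congruence by \<open>P\<close> is undone by \<open>Q\<close>, so a nonzero
    parameter vector gives a nonzero \<open>X\<close>.\<close>
  have "S = Q * X * transpose_mat Q"
  proof -
    have "transpose_mat P * transpose_mat Q = 1\<^sub>m n"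
      using PQ(2) P Q by (simp flip: transpose_mult[of _ n n _ n])
    then have "Q * X * transpose_mat Q = (Q * P) * S * 1\<^sub>m n"
      using P Q S by (simp add: X_def assoc_mult_mat[of _ n n _ n _ n])
    then show ?thesis using PQ(2) S by simp
  qed
  then have "S = 0\<^sub>m n n" using Q \<open>X = 0\<^sub>m n n\<close> by simp
  obtain i j where ij: "i \<le> j" "j < n" "es ! i = es ! j" "x (i, j) \<noteq> 0"
    using x0 n by auto
  then have "S $$ (i, j) = x (i, j)" by (simp add: S_def)
  with \<open>S = 0\<^sub>m n n\<close> ij show False by simp
qed

section \<open>The rescaled matrix, its eigenvectors and its centralizer\<close>

text \<open>The rows of \<open>S\<^sup>-\<^sup>1 B S\<close> for the diagonal matrix \<open>S\<close> with entries \<open>scale\<close>, that is,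
  1 for the first six vertices and \<open>sqrt 2\<close> for the others.\<close>

definition C_rows :: "real list list" where
  "C_rows =
    [[1, -1, 0, 0, 0, -1, 2, 0, 0, 0, 0, 0],
     [-1, 1, -1, 0, 0, 0, 0, 2, 0, 0, 0, 0],
     [0, -1, 1, -1, 0, 0, 0, 0, 2, 0, 0, 0],
     [0, 0, -1, 1, -1, 0, 2, 0, 0, 0, 0, 0],
     [0, 0, 0, -1, 1, -1, 0, 2, 0, 0, 0, 0],
     [-1, 0, 0, 0, -1, 1, 0, 0, 2, 0, 0, 0],
     [1, 0, 0, 1, 0, 0, -2, 0, 0, 2, 0, 0],
     [0, 1, 0, 0, 1, 0, 0, -2, 0, 0, 2, 0],
     [0, 0, 1, 0, 0, 1, 0, 0, -2, 0, 0, 2],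
     [0, 0, 0, 0, 0, 0, 2, 0, 0, 0, 1, 1],
     [0, 0, 0, 0, 0, 0, 0, 2, 0, 1, 0, 1],
     [0, 0, 0, 0, 0, 0, 0, 0, 2, 1, 1, 0]]"

definition C_mat :: "real mat" where
  "C_mat = mat 12 12 (\<lambda>(i, j). C_rows ! i ! j)"

text \<open>The columns are eigenvectors for the eigenvalues -4 (three), 0 (five) and 3 (four).\<close>

definition P_mat :: "real mat" where
  "P_mat = mat 12 12 (\<lambda>(i, j).
    [[2, 1, 1, 2, 1, 1, 1, 0, 11, -5, -5, 1],
     [1, 2, 1, 1, 2, 1, 1, 1, -5, 11, -5, -1],
     [1, 1, 2, 1, 1, 2, 0, 1, -5, -5, 11, 1],
     [2, 1, 1, 2, 1, 1, -1, 0, 11, -5, -5, -1],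
     [1, 2, 1, 1, 2, 1, -1, -1, -5, 11, -5, 1],
     [1, 1, 2, 1, 1, 2, 0, -1, -5, -5, 11, -1],
     [-4, -1, -1, 0, 1, 1, 0, 0, 6, -2, -2, 0],
     [-1, -4, -1, 1, 0, 1, 0, 0, -2, 6, -2, 0],
     [-1, -1, -4, 1, 1, 0, 0, 0, -2, -2, 6, 0],
     [2, 0, 0, -2, 0, 0, 0, 0, 4, 0, 0, 0],
     [0, 2, 0, 0, -2, 0, 0, 0, 0, 4, 0, 0],
     [0, 0, 2, 0, 0, -2, 0, 0, 0, 0, 4, 0]] ! i ! j)"

text \<open>The inverse of \<open>P_mat\<close>; its rows are left eigenvectors of
  \<open>C_mat\<close>.\<close>

definition Q_mat :: "real mat" where
  "Q_mat = mat 12 12 (\<lambda>(i, j).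
    [[1 / 28, 0, 0, 1 / 28, 0, 0, -5 / 28, 1 / 28, 1 / 28, 3 / 28, -1 / 28, -1 / 28],
     [0, 1 / 28, 0, 0, 1 / 28, 0, 1 / 28, -5 / 28, 1 / 28, -1 / 28, 3 / 28, -1 / 28],
     [0, 0, 1 / 28, 0, 0, 1 / 28, 1 / 28, 1 / 28, -5 / 28, -1 / 28, -1 / 28, 3 / 28],
     [1 / 12, 0, 0, 1 / 12, 0, 0, -1 / 12, 1 / 12, 1 / 12, -1 / 4, 1 / 12, 1 / 12],
     [0, 1 / 12, 0, 0, 1 / 12, 0, 1 / 12, -1 / 12, 1 / 12, 1 / 12, -1 / 4, 1 / 12],
     [0, 0, 1 / 12, 0, 0, 1 / 12, 1 / 12, 1 / 12, -1 / 12, 1 / 12, 1 / 12, -1 / 4],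
     [1 / 3, 1 / 6, -1 / 6, -1 / 3, -1 / 6, 1 / 6, 0, 0, 0, 0, 0, 0],
     [-1 / 6, 1 / 6, 1 / 3, 1 / 6, -1 / 6, -1 / 3, 0, 0, 0, 0, 0, 0],
     [1 / 42, 0, 0, 1 / 42, 0, 0, 1 / 21, 1 / 42, 1 / 42, 1 / 14, 5 / 84, 5 / 84],
     [0, 1 / 42, 0, 0, 1 / 42, 0, 1 / 42, 1 / 21, 1 / 42, 5 / 84, 1 / 14, 5 / 84],
     [0, 0, 1 / 42, 0, 0, 1 / 42, 1 / 42, 1 / 42, 1 / 21, 5 / 84, 5 / 84, 1 / 14],
     [1 / 6, -1 / 6, 1 / 6, -1 / 6, 1 / 6, -1 / 6, 0, 0, 0, 0, 0, 0]] ! i ! j)"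

text \<open>Spells out index ranges for entrywise computation. The index 1 appears as
  \<open>Suc 0\<close>, the form that the simplifier produces.\<close>

lemma all_less_12: "(\<forall>i<12. P i) \<longleftrightarrow> P 0 \<and> P (Suc 0) \<and> P 2 \<and> P 3 \<and> P 4 \<and> P 5 \<and> P 6 \<and> P 7
  \<and> P 8 \<and> P 9 \<and> P 10 \<and> P (11 :: nat)"
  by (simp add: eval_nat_numeral All_less_Suc2)

lemma sum_less_12: "(\<Sum>i = 0..<12. f i) = f 0 + f (Suc 0) + f 2 + f 3 + f 4 + f 5 + f 6 + f 7
  + f 8 + f 9 + f 10 + f (11 :: nat)" for f :: "nat \<Rightarrow> 'a :: comm_monoid_add"
  by (simp add: eval_nat_numeral add_ac)

lemma mats_12_carrier [simp]:
  "C_mat \<in> carrier_mat 12 12" "P_mat \<in> carrier_mat 12 12" "Q_mat \<in> carrier_mat 12 12"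
  by (simp_all add: C_mat_def P_mat_def Q_mat_def)

lemma B_mat_carrier [simp]: "B_mat \<in> carrier_mat 12 12"
  by (rule carrier_matI) (simp_all add: B_mat_def mat_of_rows_list_def)

lemma mult_mat_12_eqI:
  fixes A B C :: "real mat"
  assumes "A \<in> carrier_mat 12 12" "B \<in> carrier_mat 12 12" "C \<in> carrier_mat 12 12"
    and "\<forall>i<12. \<forall>j<12. (\<Sum>k = 0..<12. A $$ (i, k) * B $$ (k, j)) = C $$ (i, j)"
  shows "A * B = C"
  using assms by (intro eq_matI) (auto simp: scalar_prod_def)

lemma C_mat_index: "\<forall>i<12. \<forall>j<12. C_mat $$ (i, j) = C_rows ! i ! j"
  by (simp add: C_mat_def)

lemmas C_mat_entries = C_mat_index[unfolded all_less_12, unfolded C_rows_def, simplified]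

text \<open>The factor 2 in the symmetry condition is the square of the scaling factor: \<open>x\<close> stands for
  \<open>S\<^sup>-\<^sup>1 X S\<close> with \<open>X\<close> symmetric.\<close>

lemma centralizer_C_mat:
  fixes x :: "nat \<Rightarrow> nat \<Rightarrow> real"
  assumes comm: "\<And>i j. i < 12 \<Longrightarrow> j < 12 \<Longrightarrow>
      (\<Sum>k = 0..<12. C_mat $$ (i, k) * x k j) = (\<Sum>k = 0..<12. x i k * C_mat $$ (k, j))"
    and zero: "\<forall>i<12. \<forall>j<12. i = j \<or> C_mat $$ (i, j) \<noteq> 0 \<longrightarrow> x i j = 0"
    and sym: "\<forall>i<12. \<forall>j<12. i < j \<longrightarrow> x i j = (if i < 6 \<and> 6 \<le> j then 2 * x j i else x j i)"
    and tr: "(\<Sum>i = 0..<12. \<Sum>k = 0..<12. \<Sum>l = 0..<12.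
      C_mat $$ (i, k) * C_mat $$ (k, l) * x l i) = 0"
  shows "\<forall>i<12. \<forall>j<12. x i j = 0"
proof -
  \<comment> \<open>Edges and the diagonal give zeros, and entries above the diagonal are rewritten
    to entries below it. Of the 66 pairs, the 48 non-edges remain as unknowns.\<close>
  note Z = zero[unfolded all_less_12, simplified C_mat_entries, simplified]
  note S = sym[unfolded all_less_12, simplified Z, simplified]
  note entries = sum_less_12 C_mat_entries Z S
  \<comment> \<open>Gaussian elimination in triangular order: an unknown solved for never occurs on
    the right of a later relation, so the relations can be used together as rewrite rules. The
    blocks \<open>s1\<close> to \<open>s9\<close> hold 47 relations, from 47 commutator entries, and
    leave only \<open>x 8 0\<close> free.\<close>
  have s1: "x 10 6 = x 9 7" "x 11 6 = x 9 8" "x 11 7 = x 10 8"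
    "x 2 0 = 2 * x 7 0 + x 5 (Suc 0) - 2 * x 6 (Suc 0)" "x 3 0 = 2 * x 8 0 + x 5 2 - 2 * x 6 2"
    "x 4 0 = 2 * x 8 0 + x 5 (Suc 0) - 2 * x 6 5"
    using comm[of 9 10] comm[of 9 11] comm[of 10 11] comm[of 0 1] comm[of 0 2] comm[of 0 5]
    by (simp add: entries; linarith)+
  have s2: "x 4 2 = 2 * x 6 5 + x 3 (Suc 0) - 2 * x 8 0"
    "x 4 (Suc 0) = 2 * x 8 (Suc 0) + x 5 2 - 2 * x 7 5"
    "x 5 2 = - x 8 (Suc 0) - x 8 3 - 2 * x 11 2" "x 7 2 = x 8 4 + x 7 5 - x 8 (Suc 0)"
    "x 7 5 = x 8 (Suc 0)" "x 6 4 = x 7 0 + x 6 2 - x 8 0"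
    using comm[of 1 4] comm[of 1 5] comm[of 2 8] comm[of 2 4] comm[of 7 8] comm[of 0 4]
    by (simp add: entries s1; linarith)+
  have s3: "x 7 3 = x 6 (Suc 0) + x 8 0 - x 6 2" "x 6 2 = x 8 0" "x 8 3 = x 6 5" "x 6 5 = x 8 0"
    "x 5 3 = 2 * x 7 0 + x 3 (Suc 0) - 2 * x 6 (Suc 0)" "x 3 (Suc 0) = x 5 (Suc 0)"
    using comm[of 1 3] comm[of 6 7] comm[of 3 5] comm[of 2 3] comm[of 2 5] comm[of 0 3]
    by (simp add: entries s1 s2; linarith)+
  have s4: "x 7 0 = x 6 (Suc 0)" "x 8 4 = x 8 (Suc 0)" "x 11 5 = x 11 2"
    "x 9 8 = 4 * x 11 2 - x 10 8" "x 9 0 = x 11 2 + x 8 (Suc 0) / 2 - x 6 (Suc 0) / 2"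
    "x 10 (Suc 0) = x 11 2 + x 8 0 / 2 - x 6 (Suc 0) / 2"
    using comm[of 3 4] comm[of 1 2] comm[of 5 8] comm[of 8 11] comm[of 0 6] comm[of 1 7]
    by (simp add: entries s1 s2 s3; linarith)+
  have s5: "x 9 3 = x 11 2 + x 8 (Suc 0) / 2 - x 6 (Suc 0) / 2"
    "x 10 4 = x 11 2 + x 8 0 / 2 - x 6 (Suc 0) / 2"
    "x 9 7 = 2 * x 8 (Suc 0) + x 10 8 - 2 * x 6 (Suc 0)"
    "x 10 8 = 2 * x 11 2 + x 8 0 - x 8 (Suc 0)"
    "x 7 6 = 2 * x 10 0 + x 5 (Suc 0) + x 8 (Suc 0) - 3 * x 6 (Suc 0)" "x 10 3 = x 10 0"
    using comm[of 3 6] comm[of 4 7] comm[of 6 9] comm[of 7 10] comm[of 0 7] comm[of 3 7]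
    by (simp add: entries s1 s2 s3 s4; linarith)+
  have s6: "x 9 (Suc 0) = x 10 0 + x 8 (Suc 0) / 2 - x 8 0 / 2"
    "x 9 4 = x 10 0 + x 8 (Suc 0) / 2 - x 8 0 / 2"
    "x 8 6 = 2 * x 11 0 + x 8 (Suc 0) + x 5 (Suc 0) - 3 * x 8 0" "x 11 3 = x 11 0"
    "x 9 2 = x 11 0 + x 8 (Suc 0) / 2 - x 6 (Suc 0) / 2"
    "x 9 5 = x 11 0 + x 8 (Suc 0) / 2 - x 6 (Suc 0) / 2"
    using comm[of 1 6] comm[of 4 6] comm[of 0 8] comm[of 3 8] comm[of 2 6] comm[of 5 6]
    by (simp add: entries s1 s2 s3 s4 s5; linarith)+
  have s7: "x 8 7 = 2 * x 11 (Suc 0) + x 8 0 + x 5 (Suc 0) - 3 * x 8 (Suc 0)"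
    "x 11 4 = x 11 (Suc 0)" "x 10 2 = x 11 (Suc 0) + x 8 0 / 2 - x 6 (Suc 0) / 2"
    "x 10 5 = x 11 (Suc 0) + x 8 0 / 2 - x 6 (Suc 0) / 2"
    using comm[of 1 8] comm[of 4 8] comm[of 2 7] comm[of 5 7]
    by (simp add: entries s1 s2 s3 s4 s5 s6; linarith)+
  have s8: "x 5 (Suc 0) = 7 * x 8 0 / 2 + x 6 (Suc 0) - 5 * x 8 (Suc 0) / 2 - 3 * x 11 2"
    "x 6 (Suc 0) = x 8 0" "x 8 (Suc 0) = x 8 0"
    using comm[of 6 11] comm[of 6 10] comm[of 7 9]
    by (simp add: entries s1 s2 s3 s4 s5 s6 s7; linarith)+
  have s9: "x 11 2 = 2 * x 10 0 + 2 * x 11 0" "x 11 0 = x 11 (Suc 0)" "x 11 (Suc 0) = x 10 0"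
    "x 10 0 = - 2 * x 8 0"
    using comm[of 0 9] comm[of 1 10] comm[of 2 11] comm[of 0 10]
    by (simp add: entries s1 s2 s3 s4 s5 s6 s7 s8; linarith)+
  note solved = s1 s2 s3 s4 s5 s6 s7 s8 s9
  \<comment> \<open>After substitution the trace is a nonzero multiple of
    \<open>x 8 0\<close>.\<close>
  have "x 8 0 = 0" using tr by (simp add: entries solved)
  then show ?thesis by (simp add: all_less_12 Z S solved)
qed

lemma P_mat_Q_mat: "P_mat * Q_mat = 1\<^sub>m 12"
  by (rule mult_mat_12_eqI) (simp_all add: all_less_12 sum_less_12 P_mat_def Q_mat_def)

lemma C_mat_P_mat:
  "C_mat * P_mat = P_mat * mat_diag 12 (nth [-4, -4, -4, 0, 0, 0, 0, 0, 3, 3, 3, 3])"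
  by (subst mat_diag_mult_right[of _ 12], simp, rule mult_mat_12_eqI)
    (simp_all add: all_less_12 sum_less_12 C_mat_entries P_mat_def)

lemma edges_C_mat:
  "\<forall>i<12. \<forall>j<12. i \<noteq> j \<longrightarrow> (C_mat $$ (i, j) \<noteq> 0 \<longleftrightarrow> {i + 1, j + 1} \<in> H_edges)"
  by (simp add: all_less_12 C_mat_entries H_edges_def doubleton_eq_iff)

section \<open>Transfer from the rescaled matrix to \<open>B_mat\<close>\<close>

definition scale :: "nat \<Rightarrow> real" where
  "scale i = (if i < 6 then 1 else sqrt 2)"

lemma scale_nonzero [simp]: "scale i \<noteq> 0"
  by (simp add: scale_def)

text \<open>Only entries joining the first six vertices to the others change:
  \<open>2 / sqrt 2\<close> above the diagonal and \<open>sqrt 2 * 1\<close> below it both become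
  \<open>sqrt 2\<close>.\<close>

lemma B_mat_index:
  "\<forall>i<12. \<forall>j<12. B_mat $$ (i, j) = scale i * C_mat $$ (i, j) / scale j"
  by (simp add: all_less_12 C_mat_entries B_mat_def mat_of_rows_list_def scale_def real_div_sqrt)

lemma B_mat_nonzero_iff: "i < 12 \<Longrightarrow> j < 12 \<Longrightarrow> B_mat $$ (i, j) \<noteq> 0 \<longleftrightarrow> C_mat $$ (i, j) \<noteq> 0"
  using B_mat_index by simp

lemma B_mat_symmetric: "symmetric_mat B_mat"
proof -
  have "\<forall>i<12. \<forall>j<12. B_mat $$ (i, j) = B_mat $$ (j, i)"
    by (simp add: all_less_12 B_mat_def mat_of_rows_list_def)
  then show ?thesis
    using carrier_matD[OF B_mat_carrier] by (auto simp: symmetric_mat_def intro!: eq_matI)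
qed

lemma B_mat_graph: "B_mat \<in> graph_matrices 12 H_edges"
  using B_mat_symmetric edges_C_mat B_mat_nonzero_iff by (simp add: graph_matrices_def)

lemma B_mat_similar_C_mat: "similar_mat B_mat C_mat"
proof (rule similar_matI)
  let ?S = "mat_diag 12 scale" and ?T = "mat_diag 12 (\<lambda>i. 1 / scale i)"
  show "{B_mat, C_mat, ?S, ?T} \<subseteq> carrier_mat 12 12" by simp
  show "?S * ?T = 1\<^sub>m 12" "?T * ?S = 1\<^sub>m 12" by simp_all
  show "B_mat = ?S * C_mat * ?T"
    using B_mat_index carrier_matD[OF B_mat_carrier]
    by (simp add: mat_diag_mult_left[of _ 12 12] mat_diag_mult_right[of _ 12])
      (auto intro!: eq_matI)
qed

lemma C_mat_similar_diag:
  "similar_mat C_mat (mat_diag 12 (nth [-4, -4, -4, 0, 0, 0, 0, 0, 3, 3, 3, 3]))"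
  (is "similar_mat _ ?D")
proof (rule similar_matI)
  have D: "?D \<in> carrier_mat 12 12" by simp
  show "{C_mat, ?D, P_mat, Q_mat} \<subseteq> carrier_mat 12 12" by simp
  show "P_mat * Q_mat = 1\<^sub>m 12" by (rule P_mat_Q_mat)
  then show "Q_mat * P_mat = 1\<^sub>m 12" by (rule mat_mult_left_right_inverse[rotated 2]) simp_all
  have "C_mat = C_mat * (P_mat * Q_mat)"
    unfolding P_mat_Q_mat by (rule right_mult_one_mat[symmetric, of _ 12]) simp
  also have "\<dots> = C_mat * P_mat * Q_mat"
    by (rule assoc_mult_mat[symmetric, of _ 12 12 _ 12 _ 12]) simp_all
  finally show "C_mat = P_mat * ?D * Q_mat" unfolding C_mat_P_mat .
qed

lemma eigenvalue_mset_B_mat: "eigenvalue_mset B_mat = {#-4, -4, -4, 0, 0, 0, 0, 0, 3, 3, 3, 3#}"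
  using eigenvalue_mset_similar_diag[of B_mat "[-4, -4, -4, 0, 0, 0, 0, 0, 3, 3, 3, 3]"]
    similar_mat_trans[OF B_mat_similar_C_mat C_mat_similar_diag]
  by (simp add: numeral_eq_Suc)

section \<open>Multiplicity lists and the failure of the SSP\<close>

lemma spectrum_eq_set_mset:
  fixes A :: "real mat"
  assumes "A \<in> carrier_mat n n"
  shows "spectrum A = set_mset (eigenvalue_mset A)"
proof -
  have "char_poly A \<noteq> 0" using degree_monic_char_poly[OF assms] by auto
  then show ?thesis
    using spectrum_root_char_poly[OF assms] by (simp add: eigenvalue_mset_def)
qed

text \<open>Taking \<open>f m = m\<close> gives the number of real eigenvalues with multiplicity,
  and \<open>f m = Suc m choose 2\<close> gives the dimension of the symmetric centralizer.\<close>

lemma sum_list_ordered_mult_list: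
  fixes A :: "real mat" and f :: "nat \<Rightarrow> nat"
  assumes "A \<in> carrier_mat n n"
  shows "(\<Sum>m\<leftarrow>ordered_mult_list A. f m)
    = (\<Sum>x\<in>set_mset (eigenvalue_mset A). f (count (eigenvalue_mset A) x))"
  unfolding ordered_mult_list_def spectrum_eq_set_mset[OF assms]
  by (simp add: sum.distinct_set_conv_list[symmetric] comp_def)

lemma ordered_mult_list_B_mat: "ordered_mult_list B_mat = [3, 5, 4]"
proof -
  have "set_mset (eigenvalue_mset B_mat) = {-4, 0, 3}"
    by (auto simp: eigenvalue_mset_B_mat)
  moreover have "sorted_list_of_set {-4, 0, 3 :: real} = [-4, 0, 3]"
    by simp
  ultimately show ?thesis
    unfolding ordered_mult_list_def spectrum_eq_set_mset[OF B_mat_carrier]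
    by (simp add: eigenvalue_mset_B_mat)
qed

lemma card_H_edges: "card H_edges = 18"
  by (simp add: H_edges_def card_insert_if doubleton_eq_iff)

lemma not_SSP:
  assumes A: "A \<in> graph_matrices 12 H_edges" and mult: "ordered_mult_list A = [3, 5, 4]"
  shows "\<not> SSP A"
proof
  assume ssp: "SSP A"
  have carrier: "A \<in> carrier_mat 12 12" and sym: "symmetric_mat A"
    and edges: "\<And>i j. i < 12 \<Longrightarrow> j < 12 \<Longrightarrow> i \<noteq> j \<Longrightarrow> A $$ (i, j) \<noteq> 0 \<longleftrightarrow> {i + 1, j + 1} \<in> H_edges"
    using A by (auto simp: graph_matrices_def)
  note sums = sum_list_ordered_mult_list[OF carrier]
  \<comment> \<open>3 + 5 + 4 = 12, so the multiplicity list already accounts for all roots.\<close>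
  have size: "size (eigenvalue_mset A) = 12"
    using sums[of "\<lambda>m. m"] by (simp add: mult size_multiset_overloaded_eq)
  \<comment> \<open>31 = 6 + 15 + 10, from the multiplicities 3, 5 and 4.\<close>
  have "31 \<le> card {(i, j). i \<le> j \<and> j < 12 \<and> (i = j \<or> A $$ (i, j) \<noteq> 0)}" (is "_ \<le> card ?J")
    using SSP_imp_card_bound[OF carrier sym size ssp] sums[of "\<lambda>m. Suc m choose 2"]
    by (simp add: mult choose_two)
  also have "card ?J \<le> card ((\<lambda>i. (i, i)) ` {..<12 :: nat})
      + card {(i, j). i < j \<and> j < 12 \<and> {i + 1, j + 1} \<in> H_edges}"
    (is "_ \<le> card ?D + card ?E")
  proof -
    have "finite ?E" by (rule finite_subset[of _ "{..12} \<times> {..12}"]) auto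
    moreover have "?J \<subseteq> ?D \<union> ?E"
    proof
      fix p
      assume "p \<in> ?J"
      then obtain i j where "p = (i, j)" "i \<le> j" "j < 12" "i = j \<or> A $$ (i, j) \<noteq> 0" by blast
      then show "p \<in> ?D \<union> ?E" using edges[of i j] by (cases "i = j") auto
    qed
    ultimately show ?thesis by (meson card_Un_le card_mono finite_UnI finite_imageI finite_lessThan le_trans)
  qed
  also have "card ?D \<le> 12" using card_image_le[of "{..<12::nat}"] by simp
  also have "card ?E \<le> card H_edges"
  proof (rule card_inj_on_le[of "\<lambda>(i, j). {i + 1, j + 1}"])
    show "inj_on (\<lambda>(i, j). {i + 1, j + 1}) ?E" by (auto simp: inj_on_def doubleton_eq_iff)
    show "(\<lambda>(i, j). {i + 1, j + 1}) ` ?E \<subseteq> H_edges" by auto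
    show "finite H_edges" by (simp add: H_edges_def)
  qed
  finally show False using card_H_edges by simp
qed

section \<open>The SMP of \<open>B_mat\<close>\<close>

lemma SMP_B_mat: "SMP B_mat"
  unfolding SMP_def Let_def
proof (intro ballI impI)
  have dim: "dim_row B_mat = 12" "dim_col B_mat = 12" using carrier_matD[OF B_mat_carrier] by simp_all
  fix X
  assume "X \<in> carrier_mat (dim_row B_mat) (dim_row B_mat)" and sym: "symmetric_mat X"
    and BX: "hadamard B_mat X = 0\<^sub>m (dim_row B_mat) (dim_row B_mat)"
    and IX: "hadamard (1\<^sub>m (dim_row B_mat)) X = 0\<^sub>m (dim_row B_mat) (dim_row B_mat)"
    and comm: "commutator B_mat X = 0\<^sub>m (dim_row B_mat) (dim_row B_mat)"
    and tr: "\<forall>i. 2 \<le> i \<and> i \<le> dim_row B_mat - 1 \<longrightarrow> mat_trace (B_mat ^\<^sub>m i * X) = 0"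
  then have X: "X \<in> carrier_mat 12 12" by (simp add: dim)
  then have dimX: "dim_row X = 12" "dim_col X = 12" by auto
  define x where "x i j = X $$ (i, j) * scale j / scale i" for i j
  have "\<forall>i<12. \<forall>j<12. x i j = 0"
  proof (rule centralizer_C_mat)
    fix i j :: nat
    assume ij: "i < 12" "j < 12"
    have "(B_mat * X) $$ (i, j) = (X * B_mat) $$ (i, j)"
      using arg_cong[OF comm, of "\<lambda>M. M $$ (i, j)"] ij by (simp add: commutator_def dim dimX)
    then have *: "(\<Sum>k = 0..<12. B_mat $$ (i, k) * X $$ (k, j))
        = (\<Sum>k = 0..<12. X $$ (i, k) * B_mat $$ (k, j))"
      using ij by (simp add: scalar_prod_def dim dimX)
    \<comment> \<open>The scale factors at the summation index \<open>k\<close> cancel, so both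
      products change by the same factor \<open>scale j / scale i\<close>.\<close>
    have "(\<Sum>k = 0..<12. C_mat $$ (i, k) * x k j)
        = scale j / scale i * (\<Sum>k = 0..<12. B_mat $$ (i, k) * X $$ (k, j))"
      using ij B_mat_index by (simp add: x_def sum_distrib_left mult_ac)
    also have "\<dots> = (\<Sum>k = 0..<12. x i k * C_mat $$ (k, j))"
      unfolding * using ij B_mat_index by (simp add: x_def sum_distrib_left mult_ac)
    finally show "(\<Sum>k = 0..<12. C_mat $$ (i, k) * x k j) = (\<Sum>k = 0..<12. x i k * C_mat $$ (k, j))" .
  next
    show "\<forall>i<12. \<forall>j<12. i = j \<or> C_mat $$ (i, j) \<noteq> 0 \<longrightarrow> x i j = 0"
    proof (intro allI impI)
      fix i j :: nat
      assume ij: "i < 12" "j < 12" and "i = j \<or> C_mat $$ (i, j) \<noteq> 0"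
      then show "x i j = 0"
        using arg_cong[OF BX, of "\<lambda>M. M $$ (i, j)"] arg_cong[OF IX, of "\<lambda>M. M $$ (i, j)"]
          B_mat_nonzero_iff[of i j]
        by (auto simp: hadamard_def dim x_def)
    qed
    show "\<forall>i<12. \<forall>j<12. i < j \<longrightarrow> x i j = (if i < 6 \<and> 6 \<le> j then 2 * x j i else x j i)"
      using symmetric_matD[OF sym X] by (auto simp: x_def scale_def field_simps)
    have "0 = mat_trace (B_mat ^\<^sub>m 2 * X)" using tr by (simp add: dim)
    also have "\<dots> = (\<Sum>i = 0..<12. \<Sum>k = 0..<12. \<Sum>l = 0..<12. B_mat $$ (i, k) * B_mat $$ (k, l) * X $$ (l, i))"
    proof -
      have "B_mat ^\<^sub>m 2 * X = B_mat * (B_mat * X)"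
        using B_mat_carrier X by (simp add: numeral_2_eq_2 assoc_mult_mat[of _ 12 12 _ 12 _ 12])
      then show ?thesis
        by (simp add: mat_trace_def scalar_prod_def dim dimX sum_distrib_left atLeast0LessThan mult.assoc)
    qed
    \<comment> \<open>Around the closed walk from \<open>i\<close> through \<open>k\<close> and
      \<open>l\<close> back to \<open>i\<close> all scale factors cancel: a trace is invariant under
      conjugation.\<close>
    also have "\<dots> = (\<Sum>i = 0..<12. \<Sum>k = 0..<12. \<Sum>l = 0..<12. C_mat $$ (i, k) * C_mat $$ (k, l) * x l i)"
      by (intro sum.cong) (simp_all add: B_mat_index x_def)
    finally show "(\<Sum>i = 0..<12. \<Sum>k = 0..<12. \<Sum>l = 0..<12. C_mat $$ (i, k) * C_mat $$ (k, l) * x l i) = 0" by simp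
  qed
  then show "X = 0\<^sub>m (dim_row B_mat) (dim_row B_mat)"
    using dim dimX by (auto simp: x_def intro!: eq_matI)
qed

theorem proposition4p2:
  shows "(\<forall>A \<in> graph_matrices 12 H_edges. ordered_mult_list A = [3, 5, 4] \<longrightarrow> \<not> SSP A) \<and>
    B_mat \<in> graph_matrices 12 H_edges \<and>
    eigenvalue_mset B_mat = {#-4, -4, -4, 0, 0, 0, 0, 0, 3, 3, 3, 3#} \<and>
    ordered_mult_list B_mat = [3, 5, 4] \<and>
    SMP B_mat"
  using not_SSP B_mat_graph eigenvalue_mset_B_mat ordered_mult_list_B_mat SMP_B_mat by blast

end
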